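(* Let $q$ be a prime number, let $b>0$ be a real number with $2\lceil b\log_2 q\rceil \le q$, and let $\mathcal{A}$ be a uniformly random subset of $\mathbb{Z}_q=\mathbb{Z}/q\mathbb{Z}$ of size $2\lceil b\log_2 q\rceil$. Then $$\Pr\big[\lceil b\log_2 q\rceil\,\mathcal{A} \neq \mathbb{Z}_q\big] \le \frac{2b\log_2 q+3}{q^{b-2}}.$$
   Context: For a subset $\mathcal{A}$ of an abelian group and a positive integer $k$, the $k$-fold sumset is $k\mathcal{A}=\{a_1+\dots+a_k : a_1,\dots,a_k\in\mathcal{A}\}$ (repetitions allowed). *)

theory Defs
  imports "HOL-Computational_Algebra.Primes" "HOL-Algebra.FiniteProduct"
    "HOL-Algebra.Elementary_Groups" "HOL-Probability.Probability"
begin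

text \<open>
  The \<open>k\<close>-fold sumset \<open>{a\<^sub>1 + \<dots> + a\<^sub>k | a\<^sub>1, \<dots>, a\<^sub>k \<in> A}\<close>, repetitions allowed, of a subset \<open>A\<close>
  of the carrier of an abelian group \<open>G\<close>. Since \<^locale>\<open>comm_group\<close> is written multiplicatively,
  the group sum is \<^const>\<open>finprod\<close>.
\<close>

definition sumset :: "('a, 'b) monoid_scheme \<Rightarrow> nat \<Rightarrow> 'a set \<Rightarrow> 'a set" where
  "sumset G k A = {finprod G a {1..k} | a. a \<in> {1..k} \<rightarrow> A}"

text \<open>
  The uniform distribution on the \<open>m\<close>-element subsets of \<open>S\<close>. It is only meaningful if \<open>S\<close> is
  finite and \<open>m \<le> card S\<close>, so that there is at least one such subset.
\<close>

definition random_subset :: "'a set \<Rightarrow> nat \<Rightarrow> 'a set pmf" where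
  "random_subset S m = pmf_of_set {A. A \<subseteq> S \<and> card A = m}"

end

theory Submission
  imports Defs
begin

text \<open>
  Draw \<open>2k\<close> independent uniform elements, arranged in \<open>k\<close> pairs. Choosing one element of each pair
  gives \<open>2\<^sup>k\<close> sums, which are uniform and pairwise independent, so by Chebyshev's inequality a fixed
  element is missed by all of them with probability at most \<open>q / 2\<^sup>k\<close>, and some element is missed
  with probability at most \<open>q\<^sup>2 / 2\<^sup>k\<close>. The set of the elements drawn has at most \<open>2k\<close> members, and
  completing it at random to exactly \<open>2k\<close> members yields the uniform random subset. As sumsets only
  grow under this completion, the same bound holds for the random subset.
\<close>

section \<open>From random tuples to random subsets\<close>

text \<open>Removing \<open>T\<close> matches these sets with the subsets of \<open>S - T\<close> of
  size \<open>n - card T\<close>. The count is the number of ways to complete the image of a tuple,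
  hence the denominator of the weights used next.\<close>

lemma card_supersets_of_card:
  assumes "finite S" "T \<subseteq> S" "card T \<le> n"
  shows "card {A. T \<subseteq> A \<and> A \<subseteq> S \<and> card A = n} = (card S - card T) choose (n - card T)"
proof -
  have fT: "finite T" using assms finite_subset by blast
  have "bij_betw (\<lambda>A. A - T) {A. T \<subseteq> A \<and> A \<subseteq> S \<and> card A = n}
      {B. B \<subseteq> S - T \<and> card B = n - card T}"
  proof (rule bij_betwI[where g = "\<lambda>B. B \<union> T"])
    show "(\<lambda>A. A - T) \<in> {A. T \<subseteq> A \<and> A \<subseteq> S \<and> card A = n} \<rightarrow>
        {B. B \<subseteq> S - T \<and> card B = n - card T}"
      using fT by (auto simp: card_Diff_subset)
    show "(\<lambda>B. B \<union> T) \<in> {B. B \<subseteq> S - T \<and> card B = n - card T} \<rightarrow>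
        {A. T \<subseteq> A \<and> A \<subseteq> S \<and> card A = n}"
    proof
      fix B assume "B \<in> {B. B \<subseteq> S - T \<and> card B = n - card T}"
      then have B: "B \<subseteq> S - T" "card B = n - card T" by auto
      then have "finite B" "B \<inter> T = {}" using assms(1) finite_subset by blast+
      then have "card (B \<union> T) = n" using B fT assms by (simp add: card_Un_disjoint)
      then show "B \<union> T \<in> {A. T \<subseteq> A \<and> A \<subseteq> S \<and> card A = n}" using B assms by auto
    qed
  qed auto
  then have "card {A. T \<subseteq> A \<and> A \<subseteq> S \<and> card A = n} = card {B. B \<subseteq> S - T \<and> card B = n - card T}"
    by (rule bij_betw_same_card)
  also have "\<dots> = card (S - T) choose (n - card T)"
    using assms by (intro n_subsets) auto
  finally show ?thesis using assms fT by (simp add: card_Diff_subset)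
qed

text \<open>
  Each tuple \<open>f\<close> distributes weight 1 evenly over the sets of size \<open>card J\<close> containing its image; by
  symmetry all these sets receive the same total weight.
\<close>

lemma card_downward_closed_subsets_le:
  fixes S :: "'a set" and J :: "'b set" and P :: "'a set \<Rightarrow> bool"
  assumes S: "finite S" and J: "finite J" "card J \<le> card S"
    and P: "\<And>A B. A \<subseteq> B \<Longrightarrow> B \<subseteq> S \<Longrightarrow> P B \<Longrightarrow> P A"
  shows "card {A. A \<subseteq> S \<and> card A = card J \<and> P A} * card S ^ card J
    \<le> card {f \<in> J \<rightarrow>\<^sub>E S. P (f ` J)} * (card S choose card J)"
proof -
  define n where "n = card J"
  define w :: "('b \<Rightarrow> 'a) \<Rightarrow> real" where
    "w f = 1 / real ((card S - card (f ` J)) choose (n - card (f ` J)))" for f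
  define W where "W A = (\<Sum>f \<in> J \<rightarrow>\<^sub>E A. w f)" for A
  define \<A> where "\<A> = {A. A \<subseteq> S \<and> card A = n}"
  have fin\<A>: "finite \<A>" unfolding \<A>_def using S by auto
  have card\<A>: "card \<A> = card S choose n" unfolding \<A>_def using S by (rule n_subsets)
  have finF: "finite (J \<rightarrow>\<^sub>E S)" using S J by (simp add: finite_PiE)
  have one: "(\<Sum>A \<in> {A \<in> \<A>. f ` J \<subseteq> A}. w f) = 1" if f: "f \<in> J \<rightarrow>\<^sub>E S" for f
  proof -
    have im: "f ` J \<subseteq> S" "card (f ` J) \<le> n"
      using f J card_image_le by (auto simp: n_def)
    have eq: "{A \<in> \<A>. f ` J \<subseteq> A} = {A. f ` J \<subseteq> A \<and> A \<subseteq> S \<and> card A = n}"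
      by (auto simp: \<A>_def)
    \<comment> \<open>\<open>card J \<le> card S\<close> ensures that at least one completion
      exists, so the weight is not a division by 0.\<close>
    have "n - card (f ` J) \<le> card S - card (f ` J)" using J by (simp add: n_def)
    then have "(card S - card (f ` J)) choose (n - card (f ` J)) > 0"
      by (rule zero_less_binomial)
    then show ?thesis unfolding eq w_def
      by (simp add: card_supersets_of_card[OF S im])
  qed
  \<comment> \<open>A bijection from \<open>A\<close> to \<open>B\<close> carries tuples in
    \<open>A\<close> to tuples in \<open>B\<close> and preserves the size of the image, on which
    alone \<open>w\<close> depends.\<close>
  have W_eq: "W A = W B" if A: "A \<in> \<A>" and B: "B \<in> \<A>" for A B
  proof -
    have "finite A" "finite B" "card A = card B"
      using A B S finite_subset by (auto simp: \<A>_def)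
    then obtain h where h: "bij_betw h A B" using finite_same_card_bij by blast
    show ?thesis unfolding W_def
    proof (rule sum.reindex_bij_witness[where i = "\<lambda>f. restrict (the_inv_into A h \<circ> f) J"
          and j = "\<lambda>f. restrict (h \<circ> f) J"])
      fix f assume f: "f \<in> J \<rightarrow>\<^sub>E A"
      have inj: "inj_on h A" using h by (simp add: bij_betw_def)
      show "restrict (the_inv_into A h \<circ> restrict (h \<circ> f) J) J = f"
      proof
        fix x
        show "restrict (the_inv_into A h \<circ> restrict (h \<circ> f) J) J x = f x"
          using PiE_mem[OF f, of x] PiE_arb[OF f, of x] the_inv_into_f_f[OF inj, of "f x"]
          by (cases "x \<in> J") auto
      qed
      show "restrict (h \<circ> f) J \<in> J \<rightarrow>\<^sub>E B"
        using PiE_mem[OF f] bij_betw_apply[OF h] by auto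
      have "restrict (h \<circ> f) J ` J = h ` (f ` J)" by auto
      moreover have "inj_on h (f ` J)" using f inj by (auto intro: inj_on_subset)
      ultimately have "card (restrict (h \<circ> f) J ` J) = card (f ` J)" by (metis card_image)
      then show "w (restrict (h \<circ> f) J) = w f" by (simp add: w_def)
    next
      fix g assume g: "g \<in> J \<rightarrow>\<^sub>E B"
      have h': "bij_betw (the_inv_into A h) B A" using h by (rule bij_betw_the_inv_into)
      show "restrict (the_inv_into A h \<circ> g) J \<in> J \<rightarrow>\<^sub>E A"
        using PiE_mem[OF g] bij_betw_apply[OF h'] by auto
      show "restrict (h \<circ> restrict (the_inv_into A h \<circ> g) J) J = g"
      proof
        fix x
        show "restrict (h \<circ> restrict (the_inv_into A h \<circ> g) J) J x = g x"
          using PiE_mem[OF g, of x] PiE_arb[OF g, of x]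
            f_the_inv_into_f_bij_betw[OF h, of "g x"]
          by (cases "x \<in> J") auto
      qed
    qed
  qed
  have W_sub: "W A = (\<Sum>f \<in> {f \<in> J \<rightarrow>\<^sub>E S. f ` J \<subseteq> A}. w f)" if "A \<in> \<A>" for A
  proof -
    have "J \<rightarrow>\<^sub>E A = {f \<in> J \<rightarrow>\<^sub>E S. f ` J \<subseteq> A}"
      using that by (auto simp: \<A>_def PiE_def Pi_def)
    then show ?thesis by (simp add: W_def)
  qed
  \<comment> \<open>Double counting: every tuple hands out weight 1, so the total is the number of
    tuples, and by \<open>W_eq\<close> each set gets an equal share of it.\<close>
  have "(\<Sum>A\<in>\<A>. W A) = (\<Sum>A\<in>\<A>. \<Sum>f \<in> {f \<in> J \<rightarrow>\<^sub>E S. f ` J \<subseteq> A}. w f)"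
    by (simp add: W_sub)
  also have "\<dots> = (\<Sum>f \<in> J \<rightarrow>\<^sub>E S. \<Sum>A \<in> {A \<in> \<A>. f ` J \<subseteq> A}. w f)"
    by (rule sum.swap_restrict[OF fin\<A> finF])
  also have "\<dots> = (\<Sum>f \<in> J \<rightarrow>\<^sub>E S. 1)" by (intro sum.cong one refl)
  also have "\<dots> = real (card S ^ n)" using J by (simp add: card_PiE n_def)
  finally have total: "(\<Sum>A\<in>\<A>. W A) = real (card S ^ n)" .
  have W: "W A * real (card S choose n) = real (card S ^ n)" if "A \<in> \<A>" for A
  proof -
    have "(\<Sum>B\<in>\<A>. W B) = (\<Sum>B\<in>\<A>. W A)" by (intro sum.cong refl W_eq that)
    then show ?thesis using total card\<A> by (simp add: mult.commute)
  qed
  let ?Bad = "{A \<in> \<A>. P A}"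
  let ?bad = "{f \<in> J \<rightarrow>\<^sub>E S. P (f ` J)}"
  have fin: "finite ?Bad" "finite ?bad" using fin\<A> finF by auto
  \<comment> \<open>\<open>P\<close> passes to subsets, so every tuple with image inside a bad set
    is itself bad: bad sets draw their weight from bad tuples only, and each of these gives at most
    1.\<close>
  have "(\<Sum>A\<in>?Bad. W A) \<le> (\<Sum>A\<in>?Bad. \<Sum>f \<in> {f \<in> ?bad. f ` J \<subseteq> A}. w f)"
  proof (rule sum_mono)
    fix A assume A: "A \<in> ?Bad"
    then have "{f \<in> J \<rightarrow>\<^sub>E S. f ` J \<subseteq> A} = {f \<in> ?bad. f ` J \<subseteq> A}"
      using P[of _ A] by (auto simp: \<A>_def)
    then show "W A \<le> (\<Sum>f \<in> {f \<in> ?bad. f ` J \<subseteq> A}. w f)" using A by (simp add: W_sub)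
  qed
  also have "\<dots> = (\<Sum>f \<in> ?bad. \<Sum>A \<in> {A \<in> ?Bad. f ` J \<subseteq> A}. w f)"
    by (rule sum.swap_restrict[OF fin])
  also have "\<dots> \<le> (\<Sum>f \<in> ?bad. \<Sum>A \<in> {A \<in> \<A>. f ` J \<subseteq> A}. w f)"
    by (intro sum_mono sum_mono2) (use fin\<A> in \<open>auto simp: w_def\<close>)
  also have "\<dots> = (\<Sum>f \<in> ?bad. 1)" by (intro sum.cong one refl) auto
  also have "\<dots> = real (card ?bad)" by simp
  finally have le: "(\<Sum>A\<in>?Bad. W A) \<le> real (card ?bad)" .
  have "real (card ?Bad * card S ^ n) = (\<Sum>A\<in>?Bad. W A * real (card S choose n))"
    by (simp add: W)
  also have "\<dots> = (\<Sum>A\<in>?Bad. W A) * real (card S choose n)" by (simp add: sum_distrib_right)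
  also have "\<dots> \<le> real (card ?bad) * real (card S choose n)"
    by (intro mult_right_mono le) simp
  finally have "real (card ?Bad * card S ^ n) \<le> real (card ?bad * (card S choose n))"
    by (simp only: of_nat_mult)
  then have "card ?Bad * card S ^ n \<le> card ?bad * (card S choose n)"
    by (simp only: of_nat_le_iff)
  moreover have "?Bad = {A. A \<subseteq> S \<and> card A = card J \<and> P A}" by (auto simp: \<A>_def n_def)
  ultimately show ?thesis by (simp add: n_def)
qed

section \<open>Second moments and uniformity by counting\<close>

text \<open>Chebyshev's inequality in counting form. The number \<open>N f\<close> of events that
  occur has mean \<open>\<mu> = card E / q\<close>, and pairwise independence bounds its variance by
  \<open>\<mu>\<close>. Avoiding all events is a deviation of \<open>\<mu>\<close>, which has
  probability at most \<open>1 / \<mu>\<close>.\<close>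

lemma card_avoiding_pairwise_independent_le:
  fixes R :: "'a \<Rightarrow> 'b \<Rightarrow> bool" and q :: nat
  assumes fin: "finite \<Omega>" "finite E" and q: "q > 0"
    and single: "\<And>Z. Z \<in> E \<Longrightarrow> card {f \<in> \<Omega>. R f Z} * q = card \<Omega>"
    and pair: "\<And>Z Z'. Z \<in> E \<Longrightarrow> Z' \<in> E \<Longrightarrow> Z \<noteq> Z' \<Longrightarrow>
      card {f \<in> \<Omega>. R f Z \<and> R f Z'} * q\<^sup>2 = card \<Omega>"
  shows "card {f \<in> \<Omega>. \<forall>Z\<in>E. \<not> R f Z} * card E \<le> q * card \<Omega>"
proof (cases "card E = 0")
  case False
  define m where "m = real (card E)"
  define w where "w = real (card \<Omega>)"
  define Q where "Q = real q"
  define N where "N f = (\<Sum>Z\<in>E. of_bool (R f Z) :: real)" for f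
  define \<mu> where "\<mu> = m / Q"
  have m: "m > 0" using False by (simp add: m_def)
  have Q: "Q > 0" using q by (simp add: Q_def)
  have c: "(\<Sum>f\<in>\<Omega>. of_bool (T f) :: real) = real (card {f \<in> \<Omega>. T f})" for T
    using fin by (simp add: of_bool_def sum.If_cases Int_def)
  have single': "real (card {f \<in> \<Omega>. R f Z}) = w / Q" if "Z \<in> E" for Z
    using single[OF that] Q unfolding w_def Q_def
    by (simp add: field_simps flip: of_nat_mult)
  have pair': "real (card {f \<in> \<Omega>. R f Z \<and> R f Z'}) = w / Q\<^sup>2"
    if "Z \<in> E" "Z' \<in> E" "Z \<noteq> Z'" for Z Z'
    using pair[OF that] Q unfolding w_def Q_def
    by (simp add: field_simps flip: of_nat_mult of_nat_power)
  have "(\<Sum>f\<in>\<Omega>. N f) = (\<Sum>Z\<in>E. real (card {f \<in> \<Omega>. R f Z}))"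
    unfolding N_def by (subst sum.swap) (simp add: c)
  also have "\<dots> = m * w / Q" by (simp add: single' m_def)
  finally have s1: "(\<Sum>f\<in>\<Omega>. N f) = m * w / Q" .
  have "(\<Sum>f\<in>\<Omega>. (N f)\<^sup>2) = (\<Sum>f\<in>\<Omega>. \<Sum>Z\<in>E. \<Sum>Z'\<in>E. of_bool (R f Z \<and> R f Z'))"
    unfolding N_def power2_eq_square sum_product by (simp add: of_bool_conj)
  also have "\<dots> = (\<Sum>Z\<in>E. \<Sum>f\<in>\<Omega>. \<Sum>Z'\<in>E. of_bool (R f Z \<and> R f Z'))"
    by (rule sum.swap)
  also have "\<dots> = (\<Sum>Z\<in>E. \<Sum>Z'\<in>E. \<Sum>f\<in>\<Omega>. of_bool (R f Z \<and> R f Z'))"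
    by (intro sum.cong refl sum.swap)
  also have "\<dots> = (\<Sum>Z\<in>E. \<Sum>Z'\<in>E. real (card {f \<in> \<Omega>. R f Z \<and> R f Z'}))"
    by (simp only: c)
  also have "\<dots> = (\<Sum>Z\<in>E. \<Sum>Z'\<in>E. if Z' = Z then w / Q else w / Q\<^sup>2)"
    by (intro sum.cong refl) (auto simp: pair' single')
  also have "\<dots> = (\<Sum>Z\<in>E. w / Q + (m - 1) * (w / Q\<^sup>2))"
  proof (rule sum.cong[OF refl])
    fix Z assume Z: "Z \<in> E"
    have "(\<Sum>Z'\<in>E. if Z' = Z then w / Q else w / Q\<^sup>2)
        = (\<Sum>Z'\<in>E. w / Q\<^sup>2 + (if Z' = Z then w / Q - w / Q\<^sup>2 else 0))"
      by (intro sum.cong) auto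
    \<comment> \<open>The diagonal term is separated from the other \<open>m - 1\<close>
      terms.\<close>
    also have "\<dots> = w / Q + (m - 1) * (w / Q\<^sup>2)"
      using Z fin by (simp add: sum.distrib m_def algebra_simps diff_divide_distrib)
    finally show "(\<Sum>Z'\<in>E. if Z' = Z then w / Q else w / Q\<^sup>2) = w / Q + (m - 1) * (w / Q\<^sup>2)" .
  qed
  also have "\<dots> = m * (w / Q + (m - 1) * (w / Q\<^sup>2))" by (simp add: m_def)
  finally have s2: "(\<Sum>f\<in>\<Omega>. (N f)\<^sup>2) = m * (w / Q + (m - 1) * (w / Q\<^sup>2))" .
  let ?B = "{f \<in> \<Omega>. \<forall>Z\<in>E. \<not> R f Z}"
  \<comment> \<open>On \<open>?B\<close> the count \<open>N\<close> vanishes, so each summand equals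
    \<open>\<mu>\<^sup>2\<close>.\<close>
  have "real (card ?B) * \<mu>\<^sup>2 = (\<Sum>f\<in>?B. (N f - \<mu>)\<^sup>2)" by (simp add: N_def)
  also have "\<dots> \<le> (\<Sum>f\<in>\<Omega>. (N f - \<mu>)\<^sup>2)" using fin by (intro sum_mono2) auto
  also have "\<dots> = (\<Sum>f\<in>\<Omega>. (N f)\<^sup>2) - 2 * \<mu> * (\<Sum>f\<in>\<Omega>. N f) + \<mu>\<^sup>2 * w"
    by (simp add: power2_diff sum.distrib sum_subtractf w_def mult_ac
        flip: sum_distrib_left sum_distrib_right)
  also have "\<dots> = w * m / Q - m * w / Q\<^sup>2"
    unfolding s1 s2 \<mu>_def using Q by (simp add: field_simps power2_eq_square)
  also have "\<dots> \<le> w * m / Q" using m by (simp add: w_def)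
  finally have "real (card ?B) * m \<le> Q * w"
    unfolding \<mu>_def using m Q by (simp add: field_simps power2_eq_square)
  then have "real (card ?B * card E) \<le> real (q * card \<Omega>)" by (simp add: m_def w_def Q_def)
  then show ?thesis by (simp only: of_nat_le_iff)
qed simp

text \<open>A \<open>T\<close> that translates \<open>X\<close> by \<open>inv y \<otimes> z\<close>
  embeds the fibre over \<open>y\<close> into the fibre over \<open>z\<close>. So all fibres are
  equally large, that is, \<open>X\<close> is uniform on the group.\<close>

lemma (in group) card_fibre_mult_card_carrier:
  assumes fin: "finite \<Omega>" "finite (carrier G)" and X: "X \<in> \<Omega> \<rightarrow> carrier G"
    and shift: "\<And>u. u \<in> carrier G \<Longrightarrow>
      \<exists>T. T ` \<Omega> \<subseteq> \<Omega> \<and> inj_on T \<Omega> \<and> (\<forall>f\<in>\<Omega>. X (T f) = X f \<otimes> u)"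
    and x: "x \<in> carrier G"
  shows "card {f \<in> \<Omega>. X f = x} * card (carrier G) = card \<Omega>"
proof -
  have le: "card {f \<in> \<Omega>. X f = y} \<le> card {f \<in> \<Omega>. X f = z}"
    if y: "y \<in> carrier G" and z: "z \<in> carrier G" for y z
  proof -
    obtain T where T: "T ` \<Omega> \<subseteq> \<Omega>" "inj_on T \<Omega>" "\<forall>f\<in>\<Omega>. X (T f) = X f \<otimes> (inv y \<otimes> z)"
      using shift[of "inv y \<otimes> z"] y z by auto
    have "y \<otimes> (inv y \<otimes> z) = z" using y z by (simp flip: m_assoc)
    then have "T ` {f \<in> \<Omega>. X f = y} \<subseteq> {f \<in> \<Omega>. X f = z}" using T by auto
    moreover have "inj_on T {f \<in> \<Omega>. X f = y}" using T(2) by (rule inj_on_subset) auto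
    ultimately show ?thesis using fin by (intro card_inj_on_le) auto
  qed
  have "card \<Omega> = (\<Sum>y\<in>carrier G. card {f \<in> \<Omega>. X f = y})"
    using sum.group[OF fin funcset_image[OF X], of "\<lambda>_. 1 :: nat"] by simp
  also have "\<dots> = (\<Sum>y\<in>carrier G. card {f \<in> \<Omega>. X f = x})"
    by (intro sum.cong refl antisym le x)
  finally show ?thesis by simp
qed

section \<open>Sums choosing one element from each pair\<close>

context comm_group
begin

text \<open>The pair with index \<open>i\<close> consists of \<open>f (i, False)\<close> and
  \<open>f (i, True)\<close>. A choice is encoded by the set \<open>Z\<close> of indices at which
  the second one is taken, so \<open>Pow I\<close> lists all choices.\<close>

definition choice_sum :: "'i set \<Rightarrow> ('i \<times> bool \<Rightarrow> 'a) \<Rightarrow> 'i set \<Rightarrow> 'a" where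
  "choice_sum I f Z = (\<Otimes>i\<in>I. f (i, i \<in> Z))"

lemma choice_sum_closed:
  "f \<in> I \<times> UNIV \<rightarrow>\<^sub>E carrier G \<Longrightarrow> choice_sum I f Z \<in> carrier G"
  unfolding choice_sum_def by (intro finprod_closed) auto

text \<open>Translation in the group of tuples. The restriction keeps the result extensional, so
  that it stays in the same \<open>PiE\<close> set, while \<open>h\<close> may be an arbitrary total
  function.\<close>

definition tuple_shift :: "'i set \<Rightarrow> ('i \<times> bool \<Rightarrow> 'a) \<Rightarrow> ('i \<times> bool \<Rightarrow> 'a) \<Rightarrow> 'i \<times> bool \<Rightarrow> 'a" where
  "tuple_shift I h f = (\<lambda>p\<in>I \<times> UNIV. f p \<otimes> h p)"

lemma tuple_shift_maps:
  assumes "h \<in> UNIV \<rightarrow> carrier G"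
  shows "tuple_shift I h ` (I \<times> UNIV \<rightarrow>\<^sub>E carrier G) \<subseteq> I \<times> UNIV \<rightarrow>\<^sub>E carrier G"
proof -
  have "f p \<otimes> h p \<in> carrier G"
    if "f \<in> I \<times> UNIV \<rightarrow>\<^sub>E carrier G" "p \<in> I \<times> UNIV" for f p
    using PiE_mem[OF that] assms by auto
  then show ?thesis unfolding tuple_shift_def by (intro image_subsetI restrict_PiE_iff[THEN iffD2]) blast
qed

lemma inj_on_tuple_shift:
  assumes h: "h \<in> UNIV \<rightarrow> carrier G"
  shows "inj_on (tuple_shift I h) (I \<times> UNIV \<rightarrow>\<^sub>E carrier G)"
proof (rule inj_onI)
  fix f g
  assume f: "f \<in> I \<times> UNIV \<rightarrow>\<^sub>E carrier G" and g: "g \<in> I \<times> UNIV \<rightarrow>\<^sub>E carrier G"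
    and eq: "tuple_shift I h f = tuple_shift I h g"
  show "f = g"
  proof (rule PiE_ext[OF f g])
    fix p assume p: "p \<in> I \<times> (UNIV :: bool set)"
    then have "f p \<otimes> h p = g p \<otimes> h p" using fun_cong[OF eq, of p] by (simp add: tuple_shift_def)
    moreover have "h p \<in> carrier G" using h by auto
    ultimately show "f p = g p" using right_cancel PiE_mem[OF f p] PiE_mem[OF g p] by blast
  qed
qed

lemma choice_sum_tuple_shift:
  assumes "f \<in> I \<times> UNIV \<rightarrow>\<^sub>E carrier G" "h \<in> UNIV \<rightarrow> carrier G"
  shows "choice_sum I (tuple_shift I h f) Z = choice_sum I f Z \<otimes> choice_sum I h Z"
proof -
  have "(\<Otimes>i\<in>I. tuple_shift I h f (i, i \<in> Z)) = (\<Otimes>i\<in>I. f (i, i \<in> Z) \<otimes> h (i, i \<in> Z))"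
    using assms by (intro finprod_cong') (auto simp: tuple_shift_def)
  also have "\<dots> = (\<Otimes>i\<in>I. f (i, i \<in> Z)) \<otimes> (\<Otimes>i\<in>I. h (i, i \<in> Z))"
    using assms by (intro finprod_multf) auto
  finally show ?thesis by (simp add: choice_sum_def)
qed

text \<open>If two choices differ at \<open>i\<close>, they use different coordinates there, which can be prescribed freely.\<close>

lemma choice_sums_surj:
  assumes I: "finite I" "i \<in> I" and Z: "i \<in> Z \<longleftrightarrow> i \<notin> Z'"
    and u: "u \<in> carrier G" and v: "v \<in> carrier G"
  shows "\<exists>h \<in> UNIV \<rightarrow> carrier G. choice_sum I h Z = u \<and> choice_sum I h Z' = v"
proof -
  define h where "h p = (if p = (i, i \<in> Z) then u else if p = (i, i \<in> Z') then v else \<one>)" for p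
  have h: "h \<in> UNIV \<rightarrow> carrier G" using u v by (auto simp: h_def)
  have "choice_sum I h Z = (\<Otimes>j\<in>I. if i = j then u else \<one>)"
    unfolding choice_sum_def using u v Z by (intro finprod_cong') (auto simp: h_def)
  moreover have "choice_sum I h Z' = (\<Otimes>j\<in>I. if i = j then v else \<one>)"
    unfolding choice_sum_def using u v Z by (intro finprod_cong') (auto simp: h_def)
  ultimately show ?thesis
    using h finprod_singleton[OF I(2,1), of "\<lambda>_. u"] finprod_singleton[OF I(2,1), of "\<lambda>_. v"] u v
    by auto
qed

text \<open>Tuple shifts translate the sums of two distinct choices by any prescribed pair of group
  elements. The sums are therefore uniform and pairwise independent, and the second moment bound
  applies to the \<open>2 ^ card I\<close> events that a choice sums to \<open>x\<close>.\<close>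

lemma card_missed_by_choice_sums_le:
  assumes I: "finite I" and G: "finite (carrier G)" and x: "x \<in> carrier G"
  shows "card {f \<in> I \<times> UNIV \<rightarrow>\<^sub>E carrier G. \<forall>Z\<in>Pow I. choice_sum I f Z \<noteq> x} * 2 ^ card I
    \<le> card (carrier G) * card (carrier G) ^ (2 * card I)"
proof (cases "I = {}")
  \<comment> \<open>With no pairs there is only one choice, whereas the uniformity argument below
    needs a second one.\<close>
  case True
  then have "card {f \<in> I \<times> UNIV \<rightarrow>\<^sub>E carrier G. \<forall>Z\<in>Pow I. choice_sum I f Z \<noteq> x} \<le> 1"
    by (auto simp: card_le_Suc0_iff_eq)
  also have "1 \<le> card (carrier G)" using G one_closed by (auto simp: Suc_le_eq card_gt_0_iff)
  finally show ?thesis using True by simp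
next
  case False
  define \<Omega> where "\<Omega> = (I \<times> (UNIV :: bool set) \<rightarrow>\<^sub>E carrier G)"
  have fin: "finite \<Omega>" using I G by (auto simp: \<Omega>_def intro!: finite_PiE)
  have card\<Omega>: "card \<Omega> = card (carrier G) ^ (2 * card I)"
    using I by (simp add: \<Omega>_def card_PiE card_cartesian_product mult.commute)
  have shift: "\<exists>T. T ` \<Omega> \<subseteq> \<Omega> \<and> inj_on T \<Omega> \<and>
      (\<forall>f\<in>\<Omega>. choice_sum I (T f) Z = choice_sum I f Z \<otimes> u \<and>
        choice_sum I (T f) Z' = choice_sum I f Z' \<otimes> v)"
    if Z: "Z \<in> Pow I" "Z' \<in> Pow I" "Z \<noteq> Z'" and u: "u \<in> carrier G" and v: "v \<in> carrier G" for Z Z' u v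
  proof -
    obtain i where i: "i \<in> Z \<longleftrightarrow> i \<notin> Z'" using Z(3) by blast
    then have "i \<in> I" using Z(1,2) by blast
    obtain h where h: "h \<in> UNIV \<rightarrow> carrier G" "choice_sum I h Z = u" "choice_sum I h Z' = v"
      using choice_sums_surj[OF I \<open>i \<in> I\<close> i u v] by blast
    show ?thesis
      using tuple_shift_maps[OF h(1), of I] inj_on_tuple_shift[OF h(1), of I]
        choice_sum_tuple_shift[OF _ h(1), of _ I] h(2,3)
      unfolding \<Omega>_def by (intro exI[of _ "tuple_shift I h"]) auto
  qed
  have single: "card {f \<in> \<Omega>. choice_sum I f Z = x} * card (carrier G) = card \<Omega>" if Z: "Z \<in> Pow I" for Z
  proof (rule card_fibre_mult_card_carrier[OF fin G _ _ x])
    show "(\<lambda>f. choice_sum I f Z) \<in> \<Omega> \<rightarrow> carrier G" by (auto simp: \<Omega>_def choice_sum_closed)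
    fix u assume u: "u \<in> carrier G"
    \<comment> \<open>The complement serves as an auxiliary partner, so that the shift for two
      choices also yields the shift for a single one.\<close>
    have "I - Z \<in> Pow I" "Z \<noteq> I - Z" using Z False by auto
    from shift[OF Z this u u] show "\<exists>T. T ` \<Omega> \<subseteq> \<Omega> \<and> inj_on T \<Omega> \<and>
        (\<forall>f\<in>\<Omega>. choice_sum I (T f) Z = choice_sum I f Z \<otimes> u)" by blast
  qed
  have pair: "card {f \<in> \<Omega>. choice_sum I f Z = x \<and> choice_sum I f Z' = x} * (card (carrier G))\<^sup>2 = card \<Omega>"
    if Z: "Z \<in> Pow I" "Z' \<in> Pow I" "Z \<noteq> Z'" for Z Z'
  proof -
    \<comment> \<open>Independence of the two sums is uniformity of their pair on the product
      group.\<close>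
    interpret GG: group "G \<times>\<times> G" by (intro DirProd_group) unfold_locales
    have "card {f \<in> \<Omega>. (choice_sum I f Z, choice_sum I f Z') = (x, x)} * card (carrier (G \<times>\<times> G)) = card \<Omega>"
    proof (rule GG.card_fibre_mult_card_carrier[OF fin])
      show "finite (carrier (G \<times>\<times> G))" using G by simp
      show "(\<lambda>f. (choice_sum I f Z, choice_sum I f Z')) \<in> \<Omega> \<rightarrow> carrier (G \<times>\<times> G)"
        by (auto simp: \<Omega>_def choice_sum_closed)
      show "(x, x) \<in> carrier (G \<times>\<times> G)" using x by simp
      fix p assume "p \<in> carrier (G \<times>\<times> G)"
      then obtain u v where p: "p = (u, v)" "u \<in> carrier G" "v \<in> carrier G" by auto
      from shift[OF Z p(2,3)] p(1) show "\<exists>T. T ` \<Omega> \<subseteq> \<Omega> \<and> inj_on T \<Omega> \<and>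
          (\<forall>f\<in>\<Omega>. (choice_sum I (T f) Z, choice_sum I (T f) Z')
            = (choice_sum I f Z, choice_sum I f Z') \<otimes>\<^bsub>G \<times>\<times> G\<^esub> p)" by simp
    qed
    moreover have "card (carrier (G \<times>\<times> G)) = (card (carrier G))\<^sup>2"
      by (simp add: card_cartesian_product power2_eq_square)
    ultimately show ?thesis by simp
  qed
  have "card {f \<in> \<Omega>. \<forall>Z\<in>Pow I. choice_sum I f Z \<noteq> x} * card (Pow I) \<le> card (carrier G) * card \<Omega>"
    using G one_closed I fin single pair
    by (intro card_avoiding_pairwise_independent_le) (auto simp: card_gt_0_iff)
  then show ?thesis using I by (simp add: card_Pow card\<Omega>) (simp add: \<Omega>_def)
qed

section \<open>Sumsets of random subsets\<close>

lemma sumset_mono: "A \<subseteq> B \<Longrightarrow> sumset G k A \<subseteq> sumset G k B"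
  unfolding sumset_def by blast

lemma sumset_subset_carrier: "A \<subseteq> carrier G \<Longrightarrow> sumset G k A \<subseteq> carrier G"
  unfolding sumset_def by (auto intro!: finprod_closed)

text \<open>A union bound over the missed elements \<open>x\<close> costs one further factor
  \<open>q\<close> and bounds the bad tuples. Having a proper sumset is inherited by subsets, so the
  bound carries over from tuples to sets of size \<open>2 * k\<close>.\<close>

lemma prob_sumset_random_subset_le:
  assumes G: "finite (carrier G)" and k: "2 * k \<le> card (carrier G)"
  shows "measure_pmf.prob (random_subset (carrier G) (2 * k)) {A. sumset G k A \<noteq> carrier G}
    \<le> (real (card (carrier G)))\<^sup>2 / 2 ^ k"
proof -
  define q where "q = card (carrier G)"
  define J where "J = {1..k} \<times> (UNIV :: bool set)"
  define P where "P A \<longleftrightarrow> sumset G k A \<noteq> carrier G" for A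
  define \<A> where "\<A> = {A. A \<subseteq> carrier G \<and> card A = 2 * k}"
  define M where "M x = {f \<in> J \<rightarrow>\<^sub>E carrier G. \<forall>Z\<in>Pow {1..k}. choice_sum {1..k} f Z \<noteq> x}" for x
  have J: "finite J" "card J = 2 * k" by (auto simp: J_def card_cartesian_product)
  have q: "card (carrier G) = q" "q > 0" using G one_closed by (auto simp: q_def card_gt_0_iff)
  have finM: "finite (M x)" for x using G J by (auto simp: M_def intro!: finite_PiE)
  have "{f \<in> J \<rightarrow>\<^sub>E carrier G. P (f ` J)} \<subseteq> (\<Union>x\<in>carrier G. M x)"
  proof
    fix f assume f: "f \<in> {f \<in> J \<rightarrow>\<^sub>E carrier G. P (f ` J)}"
    then have "f ` J \<subseteq> carrier G" by auto
    then obtain x where x: "x \<in> carrier G" "x \<notin> sumset G k (f ` J)"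
      using f sumset_subset_carrier[of "f ` J" k] by (auto simp: P_def)
    \<comment> \<open>The summands \<open>f (i, i \<in> Z)\<close> all lie in the image of
      \<open>f\<close>, so an element outside the sumset is missed by every choice.\<close>
    have "choice_sum {1..k} f Z \<in> sumset G k (f ` J)" for Z
      unfolding sumset_def choice_sum_def by (auto simp: J_def)
    then have "f \<in> M x" using x f by (auto simp: M_def)
    then show "f \<in> (\<Union>x\<in>carrier G. M x)" using x by blast
  qed
  then have "card {f \<in> J \<rightarrow>\<^sub>E carrier G. P (f ` J)} \<le> card (\<Union>x\<in>carrier G. M x)"
    using G finM by (intro card_mono) auto
  also have "\<dots> \<le> (\<Sum>x\<in>carrier G. card (M x))" by (rule card_UN_le[OF G])
  finally have "card {f \<in> J \<rightarrow>\<^sub>E carrier G. P (f ` J)} * 2 ^ k \<le> (\<Sum>x\<in>carrier G. card (M x) * 2 ^ k)"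
    by (simp flip: sum_distrib_right)
  also have "\<dots> \<le> (\<Sum>x\<in>carrier G. q * q ^ (2 * k))"
    using card_missed_by_choice_sums_le[OF _ G, of "{1..k}"]
    by (intro sum_mono) (simp add: M_def J_def q_def)
  also have "\<dots> = q\<^sup>2 * q ^ (2 * k)" by (simp add: q power2_eq_square)
  finally have tuples: "card {f \<in> J \<rightarrow>\<^sub>E carrier G. P (f ` J)} * 2 ^ k \<le> q\<^sup>2 * q ^ (2 * k)" .
  have subsets: "card {A \<in> \<A>. P A} * q ^ (2 * k)
      \<le> card {f \<in> J \<rightarrow>\<^sub>E carrier G. P (f ` J)} * (q choose (2 * k))"
  proof -
    have "P A" if "A \<subseteq> B" "B \<subseteq> carrier G" "P B" for A B
      using that sumset_mono[of A B k] sumset_subset_carrier[of B k] by (auto simp: P_def)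
    from card_downward_closed_subsets_le[OF G J(1), of P, OF _ this] k J q
    show ?thesis by (simp add: \<A>_def)
  qed
  have "(card {A \<in> \<A>. P A} * 2 ^ k) * q ^ (2 * k) = (card {A \<in> \<A>. P A} * q ^ (2 * k)) * 2 ^ k"
    by (simp only: mult_ac)
  also have "\<dots> \<le> (card {f \<in> J \<rightarrow>\<^sub>E carrier G. P (f ` J)} * (q choose (2 * k))) * 2 ^ k"
    by (rule mult_right_mono[OF subsets]) simp
  also have "\<dots> = (card {f \<in> J \<rightarrow>\<^sub>E carrier G. P (f ` J)} * 2 ^ k) * (q choose (2 * k))"
    by (simp only: mult_ac)
  also have "\<dots> \<le> (q\<^sup>2 * q ^ (2 * k)) * (q choose (2 * k))"
    by (rule mult_right_mono[OF tuples]) simp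
  \<comment> \<open>The common positive factor \<open>q ^ (2 * k)\<close>, the number of all tuples,
    cancels.\<close>
  finally have "card {A \<in> \<A>. P A} * 2 ^ k \<le> q\<^sup>2 * (q choose (2 * k))"
    using q by (simp add: mult_ac)
  then have "real (card {A \<in> \<A>. P A} * 2 ^ k) \<le> real (q\<^sup>2 * (q choose (2 * k)))"
    by (simp only: of_nat_le_iff)
  then have bound: "real (card {A \<in> \<A>. P A}) * 2 ^ k \<le> (real q)\<^sup>2 * real (q choose (2 * k))"
    by simp
  have card\<A>: "card \<A> = q choose (2 * k)" unfolding \<A>_def using n_subsets[OF G] q by simp
  \<comment> \<open>Some subset of the required size exists, so \<open>pmf_of_set\<close> really is
    the uniform distribution.\<close>
  moreover have pos: "q choose (2 * k) > 0" using k by (simp add: q_def)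
  ultimately have \<A>: "finite \<A>" "\<A> \<noteq> {}" by (auto intro: card_ge_0_finite)
  have "measure_pmf.prob (random_subset (carrier G) (2 * k)) {A. P A}
      = real (card {A \<in> \<A>. P A}) / real (q choose (2 * k))"
    unfolding random_subset_def using measure_pmf_of_set[OF \<A>(2,1)] card\<A>
    by (simp add: \<A>_def Int_def)
  also have "\<dots> \<le> (real q)\<^sup>2 / 2 ^ k"
    using bound pos by (simp add: field_simps)
  finally show ?thesis by (simp add: P_def q_def)
qed

end

section \<open>The bound for the cyclic group of order \<open>q\<close>\<close>

theorem theorem2p1:
  fixes q :: nat and b :: real
  assumes "prime q"
    and "b > 0"
    and "2 * \<lceil>b * log 2 (real q)\<rceil> \<le> int q"
  shows "measure_pmf.prob
           (random_subset (carrier (integer_mod_group q)) (2 * nat \<lceil>b * log 2 (real q)\<rceil>))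
           {A. sumset (integer_mod_group q) (nat \<lceil>b * log 2 (real q)\<rceil>) A
                 \<noteq> carrier (integer_mod_group q)}
         \<le> (2 * b * log 2 (real q) + 3) / real q powr (b - 2)"
proof -
  define k where "k = nat \<lceil>b * log 2 (real q)\<rceil>"
  interpret comm_group "integer_mod_group q" by (rule abelian_integer_mod_group)
  have q: "q \<ge> 2" using assms(1) by (rule prime_ge_2_nat)
  then have carrier: "carrier (integer_mod_group q) = {0..<int q}"
    by (simp add: carrier_integer_mod_group)
  have log_nonneg: "b * log 2 (real q) \<ge> 0" using q assms(2) by simp
  have k: "2 * k \<le> q" using assms(3) unfolding k_def by linarith
  have "b * log 2 (real q) \<le> real k" unfolding k_def by linarith
  then have "2 powr (b * log 2 (real q)) \<le> 2 powr real k" by simp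
  \<comment> \<open>\<open>2 powr log 2 q\<close> is \<open>q\<close>, so rounding the exponent up
    to \<open>k\<close> gives at least \<open>q powr b\<close>.\<close>
  then have pow: "real q powr b \<le> 2 ^ k"
    using q by (simp add: powr_realpow mult.commute[of b] flip: powr_powr)
  have "measure_pmf.prob (random_subset (carrier (integer_mod_group q)) (2 * k))
      {A. sumset (integer_mod_group q) k A \<noteq> carrier (integer_mod_group q)} \<le> (real q)\<^sup>2 / 2 ^ k"
    using prob_sumset_random_subset_le[of k] k by (simp add: carrier)
  also have "\<dots> \<le> (real q)\<^sup>2 / real q powr b"
    using pow q by (intro divide_left_mono) auto
  also have "\<dots> = 1 / real q powr (b - 2)"
    using q by (simp add: powr_diff powr_numeral)
  \<comment> \<open>The logarithmic term is nonnegative, so the numerator is at least 3 and in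
    particular at least 1.\<close>
  also have "\<dots> \<le> (2 * b * log 2 (real q) + 3) / real q powr (b - 2)"
    using log_nonneg by (intro divide_right_mono) auto
  finally show ?thesis unfolding k_def .
qed

end
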